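(* Let $I\subset\mathbb{R}$ be a nontrivial interval and let $\mathcal{F}\subset\mathcal{C}^{1\#}(I)$. Then (i) $\mathscr{U}_{\mathcal{F}}$ equals $\mathscr{A}_u$ for some $u\in\mathcal{C}^{1\#}(I)$ or equals $\max$; (ii) $\mathscr{L}_{\mathcal{F}}$ equals $\mathscr{A}_\ell$ for some $\ell\in\mathcal{C}^{1\#}(I)$ or equals $\min$.
   Context: $I$ denotes a nontrivial interval. $\mathcal{CM}(I)$ is the family of continuous, strictly monotone functions $f\colon I\to\mathbb{R}$. $\mathcal{C}^{1\#}(I)$ is the family of all $\mathcal{C}^1$ functions $I\to\mathbb{R}$ with nowhere vanishing first derivative. For $f\in\mathcal{CM}(I)$ the quasi-arithmetic mean $\mathscr{A}_f\colon\bigcup_{n=1}^\infty I^n\to I$ is defined by $$\mathscr{A}_f(v):=f^{-1}\left(\frac{f(v_1)+\cdots+f(v_n)}{n}\right)\qquad(n\in\mathbb{N},\ v\in I^n).$$ Inequalities between means are understood pointwise on $\bigcup_{n=1}^\infty I^n$. For $f\in\mathcal{CM}(I)$ put $$U_f:=\{s\in\mathcal{CM}(I):\mathscr{A}_f\le\mathscr{A}_s\},\qquad L_f:=\{s\in\mathcal{CM}(I):\mathscr{A}_f\ge\mathscr{A}_s\}.$$ For $\mathcal{F}\subset\mathcal{CM}(I)$ the functions $\mathscr{U}_{\mathcal{F}},\mathscr{L}_{\mathcal{F}}\colon\bigcup_{n=1}^\infty I^n\to I$ are defined as follows: $\mathscr{U}_{\mathcal{F}}(v):=\inf\{\mathscr{A}_s(v):s\in\bigcap_{f\in\mathcal{F}}U_f\}$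 if $\bigcap_{f\in\mathcal{F}}U_f\ne\emptyset$, and $\mathscr{U}_{\mathcal{F}}(v):=\max(v)$ otherwise; $\mathscr{L}_{\mathcal{F}}(v):=\sup\{\mathscr{A}_s(v):s\in\bigcap_{f\in\mathcal{F}}L_f\}$ if $\bigcap_{f\in\mathcal{F}}L_f\ne\emptyset$, and $\mathscr{L}_{\mathcal{F}}(v):=\min(v)$ otherwise. Here $\max$ and $\min$ denote the means $v\mapsto\max(v_1,\dots,v_n)$ and $v\mapsto\min(v_1,\dots,v_n)$.
   Formalization: The family F is assumed nonempty, and C^{1#}(I) is read as continuous on I with continuous nonvanishing derivative on the interior of I only; with one-sided derivatives at endpoints the claim fails, e.g. on [0,1] for generators with derivatives max(x, e^{-n}). *)

theory Defs
  imports "HOL-Analysis.Analysis"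
begin

text \<open>
  A function on an interval \<open>I\<close> is represented by a total function on the reals; every notion below
  depends only on its values on \<open>I\<close>. The disjoint union of the powers of \<open>I\<close> is represented by the
  nonempty lists with entries in \<open>I\<close>.
\<close>

definition vectors :: "real set \<Rightarrow> real list set" where
  "vectors I = {v. v \<noteq> [] \<and> set v \<subseteq> I}"

definition CM :: "real set \<Rightarrow> (real \<Rightarrow> real) set" where
  "CM I = {f. continuous_on I f \<and> (strict_mono_on I f \<or> strict_antimono_on I f)}"

text \<open>
  At an endpoint belonging to \<open>I\<close> only continuity is required; the derivative is taken at the
  interior points. If \<open>I\<close> is open this is the usual class. Requiring nonzero
  one-sided derivatives at the endpoints would not give a class closed under envelopes: on
  \<open>[0,1]\<close>, generators with derivatives \<open>max x (exp (-n))\<close> have as upper envelope the mean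
  generated by \<open>x^2\<close>, whose derivative vanishes at \<open>0\<close>.
\<close>

definition C1_sharp :: "real set \<Rightarrow> (real \<Rightarrow> real) set" where
  "C1_sharp I = {f. continuous_on I f \<and> f C1_differentiable_on (interior I) \<and>
     (\<forall>x\<in>interior I. deriv f x \<noteq> 0)}"

definition qa_mean :: "real set \<Rightarrow> (real \<Rightarrow> real) \<Rightarrow> real list \<Rightarrow> real" where
  "qa_mean I f v = inv_into I f (sum_list (map f v) / real (length v))"

definition upper_gens :: "real set \<Rightarrow> (real \<Rightarrow> real) \<Rightarrow> (real \<Rightarrow> real) set" where
  "upper_gens I f = {s \<in> CM I. \<forall>v\<in>vectors I. qa_mean I f v \<le> qa_mean I s v}"

definition lower_gens :: "real set \<Rightarrow> (real \<Rightarrow> real) \<Rightarrow> (real \<Rightarrow> real) set" where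
  "lower_gens I f = {s \<in> CM I. \<forall>v\<in>vectors I. qa_mean I f v \<ge> qa_mean I s v}"

text \<open>The envelopes are meant for nonempty \<open>F\<close>, for which the intersections lie inside \<open>CM I\<close>.\<close>

definition upper_env :: "real set \<Rightarrow> (real \<Rightarrow> real) set \<Rightarrow> real list \<Rightarrow> real" where
  "upper_env I F v =
     (if (\<Inter>f\<in>F. upper_gens I f) \<noteq> {}
      then (INF s\<in>(\<Inter>f\<in>F. upper_gens I f). qa_mean I s v)
      else Max (set v))"

definition lower_env :: "real set \<Rightarrow> (real \<Rightarrow> real) set \<Rightarrow> real list \<Rightarrow> real" where
  "lower_env I F v =
     (if (\<Inter>f\<in>F. lower_gens I f) \<noteq> {}
      then (SUP s\<in>(\<Inter>f\<in>F. lower_gens I f). qa_mean I s v)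
      else Min (set v))"

end

theory Submission
  imports Defs
begin

text \<open>
  Generators may be taken increasing. If \<open>f\<close> is such a generator with positive derivative, then
  \<open>A_f \<le> A_s\<close> means that \<open>s\<close> is a convex function of \<open>f\<close>; hence \<open>s\<close> has a positive right derivative
  \<open>s'\<close> in the interior of \<open>I\<close>, and the condition becomes that \<open>ln s' - ln f'\<close> is nondecreasing.
  Among all functions \<open>k\<close> such that \<open>k - ln f'\<close> is nondecreasing for every \<open>f\<close> in the family there is
  one, \<open>h\<close>, with smallest increments, and it is continuous because the functions \<open>ln f'\<close> are. An
  antiderivative \<open>u\<close> of \<open>exp h\<close> extends continuously to the endpoints belonging to \<open>I\<close> and generates
  the upper envelope, which is therefore attained. The lower envelope is obtained by reflecting
  \<open>I\<close> at \<open>0\<close>.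
\<close>

subsection \<open>Intervals and right derivatives\<close>

lemma interior_between:
  fixes I :: "real set"
  assumes "is_interval I" "a \<in> I" "b \<in> I" "a < t" "t < b"
  shows "t \<in> interior I"
proof -
  have "{a<..<b} \<subseteq> I"
    using assms mem_is_interval_1_I[of I a b] by (meson greaterThanLessThan_iff less_imp_le subsetI)
  then show ?thesis
    using assms by (intro interiorI[of "{a<..<b}"]) auto
qed

lemma interior_around:
  fixes I :: "real set"
  assumes "x \<in> interior I"
  obtains a b where "a \<in> interior I" "b \<in> interior I" "a < x" "x < b"
proof -
  obtain e where "e > 0" "ball x e \<subseteq> interior I"
    using assms open_contains_ball open_interior by blast
  then have "x - e/2 \<in> interior I" "x + e/2 \<in> interior I"
    by (auto simp: dist_real_def subset_eq)
  with that[of "x - e/2" "x + e/2"] \<open>e > 0\<close> show thesis by simp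
qed

lemma endpoint_cases:
  fixes I :: "real set"
  assumes "is_interval I" "x \<in> I" "x \<notin> interior I"
  shows "(\<forall>t\<in>I. t \<le> x) \<or> (\<forall>t\<in>I. x \<le> t)"
  using assms interior_between by (metis not_le)

text \<open>For a small slope \<open>- e'\<close>, the points where \<open>w\<close> is not below
  the line of that slope through \<open>(a, w a)\<close> form a closed set. If its supremum were
  less than \<open>b\<close>, the nonnegative right derivative there would produce a later point of
  the set. Letting \<open>e'\<close> shrink gives the claim.\<close>

lemma nonneg_right_deriv_imp_le_half_open:
  fixes w :: "real \<Rightarrow> real"
  assumes "a \<le> b" and cont: "continuous_on {a..b} w"
    and deriv: "\<And>x. a \<le> x \<Longrightarrow> x < b \<Longrightarrow> \<exists>d\<ge>0. (w has_real_derivative d) (at_right x)"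
  shows "w a \<le> w b"
proof (rule field_le_epsilon)
  fix e :: real assume "e > 0"
  \<comment> \<open>The summand 1 keeps the denominator positive when \<open>a = b\<close>.\<close>
  define e' where "e' = e / (b - a + 1)"
  have e': "e' > 0" using \<open>e > 0\<close> \<open>a \<le> b\<close> by (simp add: e'_def)
  define S where "S = {t \<in> {a..b}. w a - e' * (t - a) \<le> w t}"
  have "closed S" unfolding S_def
    by (intro continuous_on_closed_Collect_le continuous_intros cont)
  moreover have "a \<in> S" using \<open>a \<le> b\<close> by (simp add: S_def)
  moreover have bdd: "bdd_above S" unfolding S_def by (rule bdd_aboveI[of _ b]) auto
  ultimately have "Sup S \<in> S" using closed_contains_Sup[of S] by blast
  define c where "c = Sup S"
  have c: "a \<le> c" "c \<le> b" "w a - e' * (c - a) \<le> w c"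
    using \<open>Sup S \<in> S\<close> by (auto simp: c_def S_def)
  have "c = b"
  proof (rule ccontr)
    assume "c \<noteq> b"
    with c have "c < b" by simp
    with deriv c obtain d where d: "d \<ge> 0" "(w has_real_derivative d) (at_right c)" by blast
    then have "((\<lambda>y. (w y - w c) / (y - c)) \<longlongrightarrow> d) (at_right c)"
      by (simp add: has_field_derivative_iff)
    then have "\<forall>\<^sub>F y in at_right c. - e' < (w y - w c) / (y - c)"
      using d(1) e' by (intro order_tendstoD(1)) auto
    moreover have "\<forall>\<^sub>F y in at_right c. y \<in> {c<..<b}"
      using \<open>c < b\<close> by (rule eventually_at_right_real)
    ultimately have "\<forall>\<^sub>F y in at_right c. - e' < (w y - w c) / (y - c) \<and> y \<in> {c<..<b}"
      by (rule eventually_conj)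
    then obtain y where y: "- e' < (w y - w c) / (y - c)" "c < y" "y < b"
      using eventually_happens'[OF trivial_limit_at_right_real] by (metis (no_types, lifting) greaterThanLessThan_iff)
    then have "- e' * (y - c) < w y - w c"
      by (simp add: pos_less_divide_eq)
    then have "w a - e' * (y - a) \<le> w y"
      using c(3) by (simp add: algebra_simps)
    then have "y \<in> S" using y c by (simp add: S_def)
    then show False using y(2) cSup_upper[of y S, OF _ bdd] by (simp add: c_def)
  qed
  then have "w a - e' * (b - a) \<le> w b" using c by simp
  moreover have "e' * (b - a) \<le> e"
    using \<open>e > 0\<close> \<open>a \<le> b\<close> by (simp add: e'_def divide_simps)
  ultimately show "w a \<le> w b + e" by simp
qed

text \<open>No derivative is assumed at \<open>a\<close>: the half-open version applies on
  \<open>{x..b}\<close> for \<open>x\<close> slightly above \<open>a\<close>, and continuity lets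
  \<open>x\<close> tend to \<open>a\<close>.\<close>

lemma nonneg_right_deriv_imp_le:
  fixes w :: "real \<Rightarrow> real"
  assumes "a \<le> b" and cont: "continuous_on {a..b} w"
    and deriv: "\<And>x. a < x \<Longrightarrow> x < b \<Longrightarrow> \<exists>d\<ge>0. (w has_real_derivative d) (at_right x)"
  shows "w a \<le> w b"
proof (cases "a = b")
  case False
  with \<open>a \<le> b\<close> have "a < b" by simp
  have "(w \<longlongrightarrow> w a) (at_right a)"
    using cont \<open>a < b\<close> by (simp add: continuous_on_Icc_at_rightD)
  moreover have "\<forall>\<^sub>F x in at_right a. w x \<le> w b"
    using eventually_at_right_real[OF \<open>a < b\<close>]
  proof eventually_elim
    case (elim x)
    show ?case
    proof (rule nonneg_right_deriv_imp_le_half_open[of x b w])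
      show "x \<le> b" "continuous_on {x..b} w"
        using elim by (auto intro: continuous_on_subset[OF cont])
      fix y assume "x \<le> y" "y < b"
      then show "\<exists>d\<ge>0. (w has_real_derivative d) (at_right y)" using elim by (intro deriv) auto
    qed
  qed
  ultimately show ?thesis
    by (intro tendsto_upperbound[of w _ "at_right a"]) auto
qed simp

text \<open>This is the supporting line of \<open>s\<close>, seen as a convex function of
  \<open>u\<close>. With \<open>q\<close> the ratio at \<open>x\<close>, \<open>s - q * u\<close>
  has right derivative \<open>du y * (ds y / du y - q)\<close>, nonnegative to the right of
  \<open>x\<close> and nonpositive to the left. The point \<open>t\<close> may be an endpoint of
  \<open>I\<close>, since derivatives enter only strictly between \<open>x\<close> and
  \<open>t\<close>.\<close>

lemma subgradient_if_deriv_ratio_mono: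
  fixes s u :: "real \<Rightarrow> real"
  assumes I: "is_interval I" and cont: "continuous_on I s" "continuous_on I u"
    and ds: "\<And>x. x \<in> interior I \<Longrightarrow> (s has_real_derivative ds x) (at_right x)"
    and du: "\<And>x. x \<in> interior I \<Longrightarrow> (u has_real_derivative du x) (at_right x)"
    and pos: "\<And>x. x \<in> interior I \<Longrightarrow> 0 < du x"
    and mono: "mono_on (interior I) (\<lambda>x. ds x / du x)"
    and x: "x \<in> interior I" and t: "t \<in> I"
  shows "ds x / du x * (u t - u x) \<le> s t - s x"
proof -
  define q where "q = ds x / du x"
  have xI: "x \<in> I" using x interior_subset by blast
  have sub: "{x..t} \<subseteq> I" "{t..x} \<subseteq> I"
    using mem_is_interval_1_I[OF I xI t] mem_is_interval_1_I[OF I t xI] by auto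
  have w: "((\<lambda>y. s y - q * u y) has_real_derivative (ds y - q * du y)) (at_right y)"
    if "y \<in> interior I" for y
    by (intro derivative_intros DERIV_cmult ds du that)
  have key: "ds y - q * du y = du y * (ds y / du y - q)" if "y \<in> interior I" for y
    using pos[OF that] by (simp add: field_simps)
  show ?thesis
  proof (cases "x \<le> t")
    case True
    have "s x - q * u x \<le> s t - q * u t"
    proof (rule nonneg_right_deriv_imp_le[OF True])
      show "continuous_on {x..t} (\<lambda>y. s y - q * u y)"
        by (intro continuous_intros continuous_on_subset[OF cont(1)] continuous_on_subset[OF cont(2)] sub)
      fix y assume y: "x < y" "y < t"
      then have yI: "y \<in> interior I" using interior_between[OF I xI t] by blast
      have "q \<le> ds y / du y" unfolding q_def
        using mono_onD[OF mono x yI] y by simp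
      then have "0 \<le> ds y - q * du y" using pos[OF yI] unfolding key[OF yI] by simp
      with w[OF yI] show "\<exists>d\<ge>0. ((\<lambda>y. s y - q * u y) has_real_derivative d) (at_right y)" by blast
    qed
    then show ?thesis by (simp add: q_def[symmetric] algebra_simps)
  next
    case False
    have "- (s t - q * u t) \<le> - (s x - q * u x)"
    proof (rule nonneg_right_deriv_imp_le[where w = "\<lambda>y. - (s y - q * u y)"])
      show "t \<le> x" using False by simp
      show "continuous_on {t..x} (\<lambda>y. - (s y - q * u y))"
        by (intro continuous_intros continuous_on_subset[OF cont(1)] continuous_on_subset[OF cont(2)] sub)
      fix y assume y: "t < y" "y < x"
      then have yI: "y \<in> interior I" using interior_between[OF I t xI] by blast
      have "ds y / du y \<le> q" unfolding q_def
        using mono_onD[OF mono yI x] y by simp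
      then have "0 \<le> - (ds y - q * du y)" using pos[OF yI] unfolding key[OF yI]
        by (simp add: mult_nonneg_nonpos)
      with DERIV_minus[OF w[OF yI]]
      show "\<exists>d\<ge>0. ((\<lambda>y. - (s y - q * u y)) has_real_derivative d) (at_right y)" by blast
    qed
    then show ?thesis by (simp add: q_def[symmetric] algebra_simps)
  qed
qed

subsection \<open>Quasi-arithmetic means\<close>

lemma strict_mono_CM: "continuous_on I f \<Longrightarrow> strict_mono_on I f \<Longrightarrow> f \<in> CM I"
  by (simp add: CM_def)

lemma CM_inj_on:
  assumes "f \<in> CM I"
  shows "inj_on f I"
proof -
  have "strict_mono_on I f \<or> strict_antimono_on I f" using assms by (simp add: CM_def)
  then show ?thesis
    unfolding inj_on_def monotone_on_def by (metis less_irrefl linorder_neqE_linordered_idom)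
qed

lemma qa_mean_eqI:
  assumes "f \<in> CM I" "x \<in> I" "f x = sum_list (map f v) / real (length v)"
  shows "qa_mean I f v = x"
  unfolding qa_mean_def assms(3)[symmetric] using CM_inj_on[OF assms(1)] assms(2) by simp

lemma sum_list_le_length_mult:
  fixes c :: real
  shows "(\<And>x. x \<in> set v \<Longrightarrow> f x \<le> c) \<Longrightarrow> sum_list (map f v) \<le> length v * c"
  by (induction v) (auto simp: algebra_simps add_mono)

lemma sum_list_ge_length_mult:
  fixes c :: real
  shows "(\<And>x. x \<in> set v \<Longrightarrow> c \<le> f x) \<Longrightarrow> length v * c \<le> sum_list (map f v)"
  by (induction v) (auto simp: algebra_simps add_mono)

lemma qa_mean_props:
  assumes I: "is_interval I" and f: "f \<in> CM I" and v: "v \<in> vectors I"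
  shows "qa_mean I f v \<in> I" "f (qa_mean I f v) = sum_list (map f v) / real (length v)"
proof -
  let ?m = "sum_list (map f v) / real (length v)"
  have ne: "v \<noteq> []" "set v \<subseteq> I" using v by (auto simp: vectors_def)
  have conn: "is_interval (f ` I)"
    using f I by (auto simp: CM_def is_interval_connected_1 intro: connected_continuous_image)
  have "Max (f ` set v) \<in> f ` set v" "Min (f ` set v) \<in> f ` set v"
    using ne by (auto intro!: Max_in Min_in)
  then have "Max (f ` set v) \<in> f ` I" "Min (f ` set v) \<in> f ` I" using ne(2) by blast+
  moreover have "?m \<le> Max (f ` set v)"
    using sum_list_le_length_mult[of v f "Max (f ` set v)"] ne by (simp add: field_simps)
  moreover have "Min (f ` set v) \<le> ?m"
    using sum_list_ge_length_mult[of v "Min (f ` set v)" f] ne by (simp add: field_simps)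
  ultimately have "?m \<in> f ` I" using mem_is_interval_1_I[OF conn] by blast
  then show "qa_mean I f v \<in> I" "f (qa_mean I f v) = ?m"
    by (auto simp: qa_mean_def inv_into_into f_inv_into_f)
qed

lemma sum_list_map_uminus: "sum_list (map (\<lambda>x. - f x) v) = - sum_list (map f v)" for f :: "'a \<Rightarrow> real"
  by (induction v) auto

lemma uminus_CM: "f \<in> CM I \<Longrightarrow> (\<lambda>x. - f x) \<in> CM I"
  by (auto simp: CM_def monotone_on_def intro: continuous_on_minus)

lemma qa_mean_uminus:
  assumes I: "is_interval I" and f: "f \<in> CM I" and v: "v \<in> vectors I"
  shows "qa_mean I (\<lambda>x. - f x) v = qa_mean I f v"
  by (intro qa_mean_eqI uminus_CM f qa_mean_props(1)[OF I f v])
    (simp add: qa_mean_props(2)[OF I f v] sum_list_map_uminus)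

text \<open>Negating a decreasing generator makes it increasing and leaves its mean
  unchanged.\<close>

lemma CM_increasing_representative:
  assumes I: "is_interval I" and f: "f \<in> CM I"
  obtains g where "continuous_on I g" "strict_mono_on I g"
    "\<And>v. v \<in> vectors I \<Longrightarrow> qa_mean I g v = qa_mean I f v"
proof (cases "strict_mono_on I f")
  case True
  with that[of f] f show thesis by (simp add: CM_def)
next
  case False
  then have "continuous_on I (\<lambda>x. - f x)" "strict_mono_on I (\<lambda>x. - f x)"
    using f by (auto simp: CM_def monotone_on_def intro: continuous_on_minus)
  with that qa_mean_uminus[OF I f] show thesis by blast
qed

lemma sum_list_subgradient:
  fixes q :: real and f s :: "'a \<Rightarrow> real"
  assumes "\<And>t. t \<in> set v \<Longrightarrow> q * (f t - f x) \<le> s t - s x"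
  shows "q * (sum_list (map f v) - length v * f x) \<le> sum_list (map s v) - length v * s x"
  using assms
proof (induction v)
  case (Cons a v)
  then have "q * (f a - f x) \<le> s a - s x"
    "q * (sum_list (map f v) - length v * f x) \<le> sum_list (map s v) - length v * s x" by auto
  then show ?case by (simp add: algebra_simps)
qed simp

text \<open>Jensen's inequality: when the supporting-line inequality at the \<open>f\<close>-mean of
  \<open>v\<close> is summed over the entries, the left side vanishes. Supporting lines are assumed
  only at interior points, so a mean lying at an endpoint is treated apart.\<close>

lemma qa_mean_le_if_subgradient:
  assumes I: "is_interval I" and f: "continuous_on I f" "strict_mono_on I f"
    and s: "continuous_on I s" "strict_mono_on I s"
    and sub: "\<And>x t. x \<in> interior I \<Longrightarrow> t \<in> I \<Longrightarrow> q x * (f t - f x) \<le> s t - s x"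
    and v: "v \<in> vectors I"
  shows "qa_mean I f v \<le> qa_mean I s v"
proof -
  define x where "x = qa_mean I f v"
  define y where "y = qa_mean I s v"
  have ne: "v \<noteq> []" "set v \<subseteq> I" using v by (auto simp: vectors_def)
  have x: "x \<in> I" "f x = sum_list (map f v) / real (length v)"
    using qa_mean_props[OF I strict_mono_CM[OF f] v] by (auto simp: x_def)
  have y: "y \<in> I" "s y = sum_list (map s v) / real (length v)"
    using qa_mean_props[OF I strict_mono_CM[OF s] v] by (auto simp: y_def)
  have le_if: "x \<le> y" if "s x \<le> s y"
    using that strict_mono_onD[OF s(2) y(1) x(1)] by (metis not_le)
  have sum_f: "sum_list (map f v) - length v * f x = 0" using x(2) ne by simp
  consider "x \<in> interior I" | "\<forall>t\<in>I. x \<le> t" | "\<forall>t\<in>I. t \<le> x"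
    using endpoint_cases[OF I x(1)] by blast
  then have "x \<le> y"
  proof cases
    case 1
    then have "0 \<le> sum_list (map s v) - length v * s x"
      using sum_list_subgradient[of v "q x" f x s] sub ne(2) sum_f by (auto simp: subset_eq)
    then show ?thesis using ne y(2) by (intro le_if) (simp add: pos_le_divide_eq mult.commute)
  next
    case 2
    then show ?thesis using y by blast
  next
    case 3
    \<comment> \<open>A mean equal to the largest element of \<open>I\<close> forces every entry to
      equal it, because the nonnegative gaps \<open>f x - f t\<close> sum to zero.\<close>
    have fle: "f t \<le> f x" if "t \<in> I" for t
      using that 3 f(2) x(1) strict_mono_on_leD by blast
    have "sum_list (map (\<lambda>t. f x - f t) v) = 0"
      using sum_f by (simp add: sum_list_subtractf sum_list_triv)
    then have "\<forall>t\<in>set v. f x - f t = 0"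
      using fle ne(2) by (subst (asm) sum_list_nonneg_eq_0_iff) auto
    then have "\<forall>t\<in>set v. t = x"
      using CM_inj_on[OF strict_mono_CM[OF f]] ne(2) x(1) by (metis eq_iff_diff_eq_0 inj_onD subsetD)
    then have "length v * s x \<le> sum_list (map s v)"
      by (intro sum_list_ge_length_mult) auto
    then show ?thesis using ne y(2) by (intro le_if) (simp add: pos_le_divide_eq mult.commute)
  qed
  then show ?thesis by (simp add: x_def y_def)
qed

section \<open>Comparison of two means as convexity of one generator over the other\<close>

locale qa_mean_le =
  fixes I :: "real set" and f s :: "real \<Rightarrow> real"
  assumes I: "is_interval I"
    and f: "continuous_on I f" "strict_mono_on I f"
    and s: "continuous_on I s" "strict_mono_on I s"
    and le: "\<And>v. v \<in> vectors I \<Longrightarrow> qa_mean I f v \<le> qa_mean I s v"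
begin

text \<open>The point \<open>p\<close> is the \<open>f\<close>-mean of \<open>[x, z]\<close>, so
  comparing the means at this single vector suffices.\<close>

lemma midpoint_le:
  assumes "x \<in> I" "z \<in> I" "p \<in> I" "f p = (f x + f z) / 2"
  shows "s p \<le> (s x + s z) / 2"
proof -
  have v: "[x, z] \<in> vectors I" using assms by (simp add: vectors_def)
  have "qa_mean I f [x, z] = p"
    using assms by (intro qa_mean_eqI strict_mono_CM f) auto
  then have "p \<le> qa_mean I s [x, z]" using le[OF v] by simp
  then have "s p \<le> s (qa_mean I s [x, z])"
    using qa_mean_props(1)[OF I strict_mono_CM[OF s] v] assms(3) strict_mono_on_leD[OF s(2)] by blast
  then show ?thesis
    using qa_mean_props(2)[OF I strict_mono_CM[OF s] v] by simp
qed

text \<open>If the graph of \<open>s\<close> over \<open>f\<close> rose above a chord, midpoint convexity would fail at the leftmost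
  point where the excess \<open>w\<close> is maximal.\<close>

lemma slopes_le:
  assumes "x \<in> I" "z \<in> I" "x < y" "y < z"
  shows "(s y - s x) / (f y - f x) \<le> (s z - s y) / (f z - f y)"
proof (rule ccontr)
  assume neg: "\<not> ?thesis"
  have sub: "{x..z} \<subseteq> I" using mem_is_interval_1_I[OF I assms(1,2)] by auto
  then have yI: "y \<in> I" using assms by auto
  have fxy: "0 < f y - f x" and fyz: "0 < f z - f y"
    using strict_mono_onD[OF f(2)] assms yI by auto
  define c where "c = (s z - s x) / (f z - f x)"
  define w where "w t = s t - s x - c * (f t - f x)" for t
  have cont_f: "continuous_on {x..z} f" using continuous_on_subset[OF f(1) sub] .
  have cont: "continuous_on {x..z} w" unfolding w_def
    by (intro continuous_intros cont_f continuous_on_subset[OF s(1) sub])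
  have wx: "w x = 0" by (simp add: w_def)
  have wz: "w z = 0" using fxy fyz by (simp add: w_def c_def)
  have "(s z - s y) * (f y - f x) < (s y - s x) * (f z - f y)"
    using neg fxy fyz by (simp add: field_simps)
  then have "(s z - s x) * (f y - f x) < (s y - s x) * (f z - f x)"
    by (simp add: algebra_simps)
  then have wy: "0 < w y" using fxy fyz by (simp add: w_def c_def field_simps)
  obtain p0 where p0: "p0 \<in> {x..z}" "\<And>t. t \<in> {x..z} \<Longrightarrow> w t \<le> w p0"
    using continuous_attains_sup[OF compact_Icc _ cont] assms by force
  define S where "S = {t \<in> {x..z}. w p0 \<le> w t}"
  have "closed S" unfolding S_def
    by (intro continuous_on_closed_Collect_le continuous_intros cont)
  moreover have "p0 \<in> S" using p0 by (simp add: S_def)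
  moreover have bdd: "bdd_below S" unfolding S_def by (rule bdd_belowI[of _ x]) auto
  ultimately have "Inf S \<in> S" using closed_contains_Inf[of S] by blast
  define p where "p = Inf S"
  have p: "p \<in> {x..z}" "w p0 \<le> w p" using \<open>Inf S \<in> S\<close> by (auto simp: S_def p_def)
  have "0 < w p0" using p0(2)[of y] wy assms by auto
  then have xpz: "x < p" "p < z" using p wx wz by (auto simp: less_le)
  have pI: "p \<in> I" using p(1) sub by blast
  \<comment> \<open>\<open>d\<close> is the largest amount by which \<open>f p\<close> can move both
    ways inside \<open>{f x..f z}\<close>. The intermediate value theorem realises the two moves at
    \<open>p1\<close> and \<open>p2\<close>. Since \<open>p1\<close> lies to the left of the
    leftmost maximum, \<open>w p1 < w p\<close> is strict, which contradicts midpoint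
    convexity.\<close>
  define d where "d = min (f p - f x) (f z - f p)"
  have d: "0 < d" "f x \<le> f p - d" "f p + d \<le> f z"
    using strict_mono_onD[OF f(2)] assms pI xpz by (auto simp: d_def)
  obtain p1 where p1: "x \<le> p1" "p1 \<le> p" "f p1 = f p - d"
    using IVT'[of f x "f p - d" p] d xpz continuous_on_subset[OF cont_f, of "{x..p}"] by auto
  obtain p2 where p2: "p \<le> p2" "p2 \<le> z" "f p2 = f p + d"
    using IVT'[of f p "f p + d" z] d xpz continuous_on_subset[OF cont_f, of "{p..z}"] by auto
  have pp: "p1 \<in> I" "p2 \<in> I" using p1 p2 xpz sub by auto
  have "p1 \<noteq> p" using p1(3) d by auto
  then have "p1 \<notin> S" using p1(2) cInf_lower[of p1 S, OF _ bdd] by (auto simp: p_def)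
  then have "w p1 < w p" using p1 xpz p(2) by (simp add: S_def)
  moreover have "w p2 \<le> w p" using p0(2)[of p2] p2 xpz p(2) by auto
  moreover have "s p \<le> (s p1 + s p2) / 2"
    using midpoint_le[OF pp pI] p1 p2 by simp
  moreover have "c * (f p1 - f x) + c * (f p2 - f x) = 2 * (c * (f p - f x))"
    by (simp add: p1(3) p2(3) algebra_simps)
  ultimately show False by (simp add: w_def)
qed

text \<open>The slope of the long chord is a weighted average of the slopes over
  \<open>{x..y}\<close> and \<open>{y..z}\<close>, and the former is the smaller one by
  \<open>slopes_le\<close>.\<close>

lemma slope_mono:
  assumes "x \<in> I" "z \<in> I" "x < y" "y \<le> z"
  shows "(s y - s x) / (f y - f x) \<le> (s z - s x) / (f z - f x)"
proof (cases "y = z")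
  case False
  with assms have yz: "y < z" by simp
  have yI: "y \<in> I" using mem_is_interval_1_I[OF I assms(1,2)] assms by auto
  have pos: "0 < f y - f x" "0 < f z - f y"
    using strict_mono_onD[OF f(2)] assms yI yz by auto
  have "(s y - s x) * (f z - f y) \<le> (s z - s y) * (f y - f x)"
    using slopes_le[OF assms(1-3) yz] pos by (simp add: field_simps)
  then have "(s y - s x) * (f z - f x) \<le> (s z - s x) * (f y - f x)"
    by (simp add: algebra_simps)
  then show ?thesis using pos by (simp add: field_simps)
qed simp

text \<open>As \<open>t\<close> falls to \<open>x\<close>, the chord slopes \<open>Q t\<close> do
  not increase, and they stay above the slope \<open>l\<close> of a chord ending at
  \<open>x\<close>. Hence they converge to their infimum \<open>q\<close>, which is at least
  \<open>l > 0\<close>; multiplying by the difference quotient of \<open>f\<close> gives the right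
  derivative \<open>q * f'\<close>.\<close>

lemma right_deriv_exists:
  assumes x: "x \<in> interior I" and f': "(f has_real_derivative f') (at x)" "0 < f'"
  shows "\<exists>d>0. (s has_real_derivative d) (at_right x)"
proof -
  define Q where "Q t = (s t - s x) / (f t - f x)" for t
  obtain a b where ab: "a \<in> I" "b \<in> I" "a < x" "x < b"
    using interior_around[OF x] interior_subset by (metis subsetD)
  have xI: "x \<in> I" using x interior_subset by blast
  define l where "l = (s x - s a) / (f x - f a)"
  have "0 < l" using strict_mono_onD[OF f(2)] strict_mono_onD[OF s(2)] ab xI by (simp add: l_def)
  have lQ: "l \<le> Q t" if "t \<in> I" "x < t" for t
    unfolding l_def Q_def using slopes_le[OF ab(1) that(1) ab(3) that(2)] .
  define q where "q = (INF t\<in>I \<inter> {x<..}. Q t)"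
  have ne: "I \<inter> {x<..} \<noteq> {}" using ab by auto
  have bdd: "bdd_below (Q ` (I \<inter> {x<..}))" using lQ by (auto intro: bdd_belowI2[of _ l])
  have "l \<le> q" unfolding q_def using lQ by (intro cINF_greatest[OF ne]) auto
  have Q: "(Q \<longlongrightarrow> q) (at_right x)"
  proof (rule order_tendstoI)
    fix c assume "c < q"
    show "\<forall>\<^sub>F t in at_right x. c < Q t"
      using eventually_at_right_real[OF ab(4)]
    proof eventually_elim
      case (elim t)
      then have "t \<in> I" using mem_is_interval_1_I[OF I xI ab(2)] by auto
      then have "q \<le> Q t" unfolding q_def using elim by (intro cINF_lower bdd) auto
      with \<open>c < q\<close> show ?case by simp
    qed
  next
    fix c assume "q < c"
    then obtain t0 where t0: "t0 \<in> I" "x < t0" "Q t0 < c"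
      unfolding q_def cINF_less_iff[OF ne bdd] by auto
    show "\<forall>\<^sub>F t in at_right x. Q t < c"
      using eventually_at_right_real[OF t0(2)]
    proof eventually_elim
      case (elim t)
      then show ?case using slope_mono[OF xI t0(1), of t] t0(3) by (auto simp: Q_def)
    qed
  qed
  have "((\<lambda>t. (f t - f x) / (t - x)) \<longlongrightarrow> f') (at_right x)"
    using has_field_derivative_at_within[OF f'(1)] by (simp add: has_field_derivative_iff)
  with Q have "((\<lambda>t. Q t * ((f t - f x) / (t - x))) \<longlongrightarrow> q * f') (at_right x)"
    by (rule tendsto_mult)
  moreover have "\<forall>\<^sub>F t in at_right x. Q t * ((f t - f x) / (t - x)) = (s t - s x) / (t - x)"
    using eventually_at_right_real[OF ab(4)]
  proof eventually_elim
    case (elim t)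
    then have "t \<in> I" using mem_is_interval_1_I[OF I xI ab(2)] by auto
    then have "f x < f t" using strict_mono_onD[OF f(2) xI] elim by auto
    then show ?case by (simp add: Q_def)
  qed
  ultimately have "((\<lambda>t. (s t - s x) / (t - x)) \<longlongrightarrow> q * f') (at_right x)"
    by (rule Lim_transform_eventually)
  then have "(s has_real_derivative q * f') (at_right x)"
    by (simp add: has_field_derivative_iff)
  moreover have "0 < q * f'" using \<open>0 < l\<close> \<open>l \<le> q\<close> f' by simp
  ultimately show ?thesis by blast
qed

lemma slope_tendsto:
  assumes "x \<in> interior I" "(f has_real_derivative f') (at x)" "0 < f'"
    and "(s has_real_derivative d) (at_right x)"
  shows "((\<lambda>t. (s t - s x) / (f t - f x)) \<longlongrightarrow> d / f') (at_right x)"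
proof -
  have "((\<lambda>t. (f t - f x) / (t - x)) \<longlongrightarrow> f') (at_right x)"
    using has_field_derivative_at_within[OF assms(2)] by (simp add: has_field_derivative_iff)
  moreover have "((\<lambda>t. (s t - s x) / (t - x)) \<longlongrightarrow> d) (at_right x)"
    using assms(4) by (simp add: has_field_derivative_iff)
  ultimately have "((\<lambda>t. ((s t - s x) / (t - x)) / ((f t - f x) / (t - x))) \<longlongrightarrow> d / f') (at_right x)"
    using assms(3) by (intro tendsto_divide) auto
  moreover have "\<forall>\<^sub>F t in at_right x. ((s t - s x) / (t - x)) / ((f t - f x) / (t - x)) = (s t - s x) / (f t - f x)"
    using eventually_at_right_less[of x] by eventually_elim simp
  ultimately show ?thesis by (rule Lim_transform_eventually)
qed

text \<open>The slope of the chord over \<open>{x..y}\<close> separates the two ratios: it bounds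
  from above the shorter chords shrinking to \<open>x\<close>, and from below the chords starting at
  \<open>y\<close>.\<close>

lemma deriv_ratio_mono:
  assumes f': "\<And>x. x \<in> interior I \<Longrightarrow> (f has_real_derivative f' x) (at x)"
    "\<And>x. x \<in> interior I \<Longrightarrow> 0 < f' x"
    and ds: "\<And>x. x \<in> interior I \<Longrightarrow> (s has_real_derivative ds x) (at_right x)"
  shows "mono_on (interior I) (\<lambda>x. ds x / f' x)"
proof (rule mono_onI)
  fix x y assume xy: "x \<in> interior I" "y \<in> interior I" "x \<le> y"
  show "ds x / f' x \<le> ds y / f' y"
  proof (cases "x = y")
    case False
    with xy have "x < y" by simp
    have I': "x \<in> I" "y \<in> I" using xy interior_subset by blast+
    obtain b where b: "b \<in> I" "y < b" using interior_around[OF xy(2)] interior_subset by (metis subsetD)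
    have "ds x / f' x \<le> (s y - s x) / (f y - f x)"
    proof (rule tendsto_upperbound[OF slope_tendsto[OF xy(1) f'(1)[OF xy(1)] f'(2)[OF xy(1)] ds[OF xy(1)]]])
      show "\<forall>\<^sub>F t in at_right x. (s t - s x) / (f t - f x) \<le> (s y - s x) / (f y - f x)"
        using eventually_at_right_real[OF \<open>x < y\<close>] slope_mono[OF I'] by (auto elim: eventually_mono)
    qed simp
    also have "\<dots> \<le> ds y / f' y"
    proof (rule tendsto_lowerbound[OF slope_tendsto[OF xy(2) f'(1)[OF xy(2)] f'(2)[OF xy(2)] ds[OF xy(2)]]])
      show "\<forall>\<^sub>F t in at_right y. (s y - s x) / (f y - f x) \<le> (s t - s y) / (f t - f y)"
        using eventually_at_right_real[OF b(2)]
      proof eventually_elim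
        case (elim t)
        then have "t \<in> I" using mem_is_interval_1_I[OF I I'(2) b(1)] by auto
        then show ?case using slopes_le[OF I'(1) _ \<open>x < y\<close>] elim by auto
      qed
    qed simp
    finally show ?thesis .
  qed simp
qed

end

subsection \<open>The least function dominating the increments of a family\<close>

text \<open>Call \<open>k\<close> admissible if \<open>k - \<phi>\<close> is nondecreasing for every
  \<phi> in \<Phi>. The infimum \<open>m x y\<close> of the increments of admissible functions is
  additive over adjacent intervals, so it is the increment of a single function \<open>h\<close>,
  which is then admissible and least. The function \<open>k0\<close> shows that admissible functions
  exist.\<close>

lemma least_increment_majorant:
  fixes J :: "real set" and \<Phi> :: "(real \<Rightarrow> real) set"
  assumes ne: "\<Phi> \<noteq> {}" and cont: "\<And>\<phi>. \<phi> \<in> \<Phi> \<Longrightarrow> continuous_on J \<phi>"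
    and k0: "\<And>\<phi>. \<phi> \<in> \<Phi> \<Longrightarrow> mono_on J (\<lambda>x. k0 x - \<phi> x)"
  obtains h where "continuous_on J h" "\<And>\<phi>. \<phi> \<in> \<Phi> \<Longrightarrow> mono_on J (\<lambda>x. h x - \<phi> x)"
    "\<And>k. (\<And>\<phi>. \<phi> \<in> \<Phi> \<Longrightarrow> mono_on J (\<lambda>x. k x - \<phi> x)) \<Longrightarrow> mono_on J (\<lambda>x. k x - h x)"
proof (cases "J = {}")
  case True
  with that show thesis by simp
next
  case False
  then obtain x0 where x0: "x0 \<in> J" by blast
  obtain \<phi>0 where \<phi>0: "\<phi>0 \<in> \<Phi>" using ne by blast
  define K where "K = {k :: real \<Rightarrow> real. \<forall>\<phi>\<in>\<Phi>. \<forall>x\<in>J. \<forall>y\<in>J. x \<le> y \<longrightarrow> \<phi> y - \<phi> x \<le> k y - k x}"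
  have K_iff: "k \<in> K \<longleftrightarrow> (\<forall>\<phi>\<in>\<Phi>. mono_on J (\<lambda>x. k x - \<phi> x))" for k
    by (fastforce simp: K_def mono_on_def)
  have KI: "k \<in> K" if "\<And>\<phi> x y. \<phi> \<in> \<Phi> \<Longrightarrow> x \<in> J \<Longrightarrow> y \<in> J \<Longrightarrow> x \<le> y \<Longrightarrow> \<phi> y - \<phi> x \<le> k y - k x" for k
    using that by (simp add: K_def)
  have KD: "\<phi> y - \<phi> x \<le> k y - k x" if "k \<in> K" "\<phi> \<in> \<Phi>" "x \<in> J" "y \<in> J" "x \<le> y" for k \<phi> x y
    using that by (simp add: K_def)
  have Kne: "K \<noteq> {}" using k0 K_iff by blast
  define m where "m x y = (INF k\<in>K. k y - k x)" for x y
  have bdd: "bdd_below ((\<lambda>k. k y - k x) ` K)" if "x \<in> J" "y \<in> J" "x \<le> y" for x y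
    using KD[OF _ \<phi>0 that] by (auto intro: bdd_belowI2[of _ "\<phi>0 y - \<phi>0 x"])
  have m_le: "m x y \<le> k y - k x" if "k \<in> K" "x \<in> J" "y \<in> J" "x \<le> y" for k x y
    unfolding m_def using that by (intro cINF_lower bdd)
  have m_ge: "c \<le> m x y" if "\<And>k. k \<in> K \<Longrightarrow> c \<le> k y - k x" for c x y
    unfolding m_def using that by (intro cINF_greatest Kne)
  have m_add: "m x z = m x y + m y z" if J: "x \<in> J" "y \<in> J" "z \<in> J" and xyz: "x \<le> y" "y \<le> z" for x y z
  proof (rule antisym)
    show "m x y + m y z \<le> m x z"
      using m_le J xyz by (intro m_ge) (smt (verit))
    have splice: "m x z \<le> (k1 y - k1 x) + (k2 z - k2 y)" if k: "k1 \<in> K" "k2 \<in> K" for k1 k2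
    proof -
      \<comment> \<open>\<open>k\<close> follows \<open>k1\<close> up to \<open>y\<close> and then
        \<open>k2\<close>, shifted to agree at \<open>y\<close>. An increment across
        \<open>y\<close> splits there, so \<open>k\<close> is again admissible.\<close>
      define k where "k t = (if t \<le> y then k1 t else k1 y + (k2 t - k2 y))" for t
      have "k \<in> K"
      proof (rule KI)
        fix \<phi> a b assume *: "\<phi> \<in> \<Phi>" "a \<in> J" "b \<in> J" "a \<le> b"
        consider "b \<le> y" | "a \<le> y" "y < b" | "y < a" by linarith
        then show "\<phi> b - \<phi> a \<le> k b - k a"
        proof cases
          case 1
          then show ?thesis using KD[OF k(1) *] * by (simp add: k_def)
        next
          case 2
          then show ?thesis using KD[OF k(1) *(1,2) J(2)] KD[OF k(2) *(1) J(2) *(3)] by (simp add: k_def)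
        next
          case 3
          then show ?thesis using KD[OF k(2) *] * by (simp add: k_def)
        qed
      qed
      then have "m x z \<le> k z - k x" using J xyz by (intro m_le) auto
      also have "\<dots> = (k1 y - k1 x) + (k2 z - k2 y)" using xyz by (auto simp: k_def)
      finally show ?thesis .
    qed
    have "m x z - (k1 y - k1 x) \<le> m y z" if "k1 \<in> K" for k1
      using splice[OF that] by (intro m_ge) (simp add: algebra_simps)
    then have "m x z - m y z \<le> m x y"
      by (intro m_ge) (simp add: algebra_simps)
    then show "m x z \<le> m x y + m y z" by simp
  qed
  \<comment> \<open>The sign change at \<open>x0\<close> makes every increment of \<open>h\<close>
    equal to \<open>m\<close>, by additivity.\<close>
  define h where "h t = (if x0 \<le> t then m x0 t else - m t x0)" for t
  have hm: "h y - h x = m x y" if "x \<in> J" "y \<in> J" "x \<le> y" for x y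
    using m_add[OF x0 that(1,2)] m_add[OF that(1) x0 that(2)] m_add[OF that(1,2) x0] that(3)
    by (auto simp: h_def)
  have hK: "h \<in> K"
    using hm by (intro KI) (auto intro!: m_ge KD)
  have h_le: "h y - h x \<le> k y - k x" if "k \<in> K" "x \<in> J" "y \<in> J" "x \<le> y" for k x y
    using hm m_le that by simp
  text \<open>A jump of \<open>h\<close> could be removed without leaving \<open>K\<close>, because the members of \<open>\<Phi>\<close> are
    continuous; by minimality there is none.\<close>
  have left: "\<exists>d>0. \<forall>t\<in>J. t < p \<and> p - t < d \<longrightarrow> \<bar>h p - h t\<bar> < e" if p: "p \<in> J" and e: "0 < e" for p e
  proof (cases "\<exists>t\<in>J. t < p")
    case True
    then obtain r where r: "r \<in> J" "r < p" by blast
    have "\<exists>x\<in>J. x < p \<and> (\<exists>\<phi>\<in>\<Phi>. h p - h x < \<phi> p - \<phi> x + e/2)"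
    proof (rule ccontr)
      assume neg: "\<not> ?thesis"
      \<comment> \<open>By \<open>neg\<close>, every \<phi> leaves a slack of at least
        \<open>e/2\<close> on each interval ending at \<open>p\<close>, so \<open>h\<close> may be
        lowered by \<open>e/2\<close> from \<open>p\<close> on. This would make the increment from
        \<open>r\<close> to \<open>p\<close> smaller than the least one.\<close>
      define k where "k t = (if t < p then h t else h t - e/2)" for t
      have "k \<in> K"
      proof (rule KI)
        fix \<phi> a b assume *: "\<phi> \<in> \<Phi>" "a \<in> J" "b \<in> J" "a \<le> b"
        show "\<phi> b - \<phi> a \<le> k b - k a"
        proof (cases "a < p \<and> p \<le> b")
          case True
          then have "\<phi> p - \<phi> a + e/2 \<le> h p - h a" using neg * by (meson not_le)
          then show ?thesis using KD[OF hK *(1) p *(3)] True by (simp add: k_def)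
        next
          case False
          then show ?thesis using KD[OF hK *] *(4) by (auto simp: k_def)
        qed
      qed
      from h_le[OF this r(1) p] r(2) e show False by (simp add: k_def)
    qed
    then obtain x \<phi> where x: "x \<in> J" "x < p" "\<phi> \<in> \<Phi>" "h p - h x < \<phi> p - \<phi> x + e/2" by blast
    obtain d where d: "d > 0" "\<And>t. t \<in> J \<Longrightarrow> \<bar>t - p\<bar> < d \<Longrightarrow> \<bar>\<phi> t - \<phi> p\<bar> < e/2"
      using cont[OF x(3)] p e unfolding continuous_on_iff dist_real_def by (metis half_gt_zero)
    show ?thesis
    proof (intro exI[of _ "min d (p - x)"] conjI ballI impI)
      \<comment> \<open>From \<open>x\<close> to \<open>p\<close> the increment of \<open>h\<close>
        exceeds that of \<phi> by less than \<open>e/2\<close>. Since \<open>h\<close> gains at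
        least as much as \<phi> from \<open>x\<close> to \<open>t\<close>, the same bound holds from
        \<open>t\<close> to \<open>p\<close>, where \<phi> itself changes by less than
        \<open>e/2\<close>.\<close>
      fix t assume t: "t \<in> J" "t < p \<and> p - t < min d (p - x)"
      then have "\<bar>\<phi> t - \<phi> p\<bar> < e/2" by (intro d(2)) auto
      moreover have "\<phi> p - \<phi> t \<le> h p - h t" using t by (intro KD[OF hK x(3) _ p]) auto
      moreover have "\<phi> t - \<phi> x \<le> h t - h x" using t by (intro KD[OF hK x(3) x(1)]) auto
      ultimately show "\<bar>h p - h t\<bar> < e" using x(4) by linarith
    qed (use d x in auto)
  qed (auto intro: exI[of _ 1])
  have right: "\<exists>d>0. \<forall>t\<in>J. p < t \<and> t - p < d \<longrightarrow> \<bar>h p - h t\<bar> < e" if p: "p \<in> J" and e: "0 < e" for p e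
  proof (cases "\<exists>t\<in>J. p < t")
    case True
    then obtain r where r: "r \<in> J" "p < r" by blast
    have "\<exists>x\<in>J. p < x \<and> (\<exists>\<phi>\<in>\<Phi>. h x - h p < \<phi> x - \<phi> p + e/2)"
    proof (rule ccontr)
      assume neg: "\<not> ?thesis"
      \<comment> \<open>Here \<open>p\<close> keeps its value and the drop starts strictly to its
        right, which lowers the increment from \<open>p\<close> to \<open>r\<close>.\<close>
      define k where "k t = (if t \<le> p then h t else h t - e/2)" for t
      have "k \<in> K"
      proof (rule KI)
        fix \<phi> a b assume *: "\<phi> \<in> \<Phi>" "a \<in> J" "b \<in> J" "a \<le> b"
        show "\<phi> b - \<phi> a \<le> k b - k a"
        proof (cases "a \<le> p \<and> p < b")
          case True
          then have "\<phi> b - \<phi> p + e/2 \<le> h b - h p" using neg * by (meson not_le)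
          then show ?thesis using KD[OF hK *(1,2) p] True by (simp add: k_def)
        next
          case False
          then show ?thesis using KD[OF hK *] *(4) by (auto simp: k_def)
        qed
      qed
      from h_le[OF this p r(1)] r(2) e show False by (simp add: k_def)
    qed
    then obtain x \<phi> where x: "x \<in> J" "p < x" "\<phi> \<in> \<Phi>" "h x - h p < \<phi> x - \<phi> p + e/2" by blast
    obtain d where d: "d > 0" "\<And>t. t \<in> J \<Longrightarrow> \<bar>t - p\<bar> < d \<Longrightarrow> \<bar>\<phi> t - \<phi> p\<bar> < e/2"
      using cont[OF x(3)] p e unfolding continuous_on_iff dist_real_def by (metis half_gt_zero)
    show ?thesis
    proof (intro exI[of _ "min d (x - p)"] conjI ballI impI)
      fix t assume t: "t \<in> J" "p < t \<and> t - p < min d (x - p)"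
      then have "\<bar>\<phi> t - \<phi> p\<bar> < e/2" by (intro d(2)) auto
      moreover have "\<phi> t - \<phi> p \<le> h t - h p" using t by (intro KD[OF hK x(3) p]) auto
      moreover have "\<phi> x - \<phi> t \<le> h x - h t" using t by (intro KD[OF hK x(3) _ x(1)]) auto
      ultimately show "\<bar>h p - h t\<bar> < e" using x(4) by linarith
    qed (use d x in auto)
  qed (auto intro: exI[of _ 1])
  have "continuous_on J h"
    unfolding continuous_on_iff dist_real_def
  proof (intro ballI allI impI)
    fix p e :: real assume p: "p \<in> J" and e: "0 < e"
    obtain d1 where d1: "d1 > 0" "\<forall>t\<in>J. t < p \<and> p - t < d1 \<longrightarrow> \<bar>h p - h t\<bar> < e"
      using left[OF p e] by blast
    obtain d2 where d2: "d2 > 0" "\<forall>t\<in>J. p < t \<and> t - p < d2 \<longrightarrow> \<bar>h p - h t\<bar> < e"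
      using right[OF p e] by blast
    show "\<exists>d>0. \<forall>t\<in>J. \<bar>t - p\<bar> < d \<longrightarrow> \<bar>h t - h p\<bar> < e"
    proof (intro exI[of _ "min d1 d2"] conjI ballI impI)
      fix t assume t: "t \<in> J" "\<bar>t - p\<bar> < min d1 d2"
      consider "t < p" | "t = p" | "p < t" by linarith
      then show "\<bar>h t - h p\<bar> < e"
        using d1(2) d2(2) t e by cases (auto simp: abs_minus_commute)
    qed (use d1 d2 in auto)
  qed
  moreover have "mono_on J (\<lambda>x. k x - h x)" if "k \<in> K" for k
    using h_le[OF that] by (intro mono_onI) (simp add: algebra_simps)
  ultimately show thesis using that hK K_iff by blast
qed

subsection \<open>Generators with nonvanishing derivative\<close>

text \<open>The oriented integral from a fixed point \<open>x0\<close> serves all \<open>x\<close>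
  at once; the fundamental theorem is applied on a compact part of \<open>J\<close> having both
  points strictly inside.\<close>

lemma antiderivative_on_open_interval:
  fixes g :: "real \<Rightarrow> real"
  assumes J: "is_interval J" "open J" and cont: "continuous_on J g"
  obtains w where "\<And>x. x \<in> J \<Longrightarrow> (w has_real_derivative g x) (at x)"
proof (cases "J = {}")
  case True
  with that show thesis by simp
next
  case False
  then obtain x0 where x0: "x0 \<in> J" by blast
  have "((\<lambda>u. LBINT y=x0..u. g y) has_real_derivative g x) (at x)" if x: "x \<in> J" for x
  proof -
    have "min x0 x \<in> interior J" "max x0 x \<in> interior J"
      using x x0 interior_open[OF J(2)] by (auto simp: min_def max_def)
    then obtain a b where ab: "a \<in> J" "b \<in> J" "a < min x0 x" "max x0 x < b"
      using interior_around[of "min x0 x" J] interior_around[of "max x0 x" J] interior_subset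
      by (metis subsetD)
    have "{a..b} \<subseteq> J" using mem_is_interval_1_I[OF J(1) ab(1,2)] by auto
    then have "((\<lambda>u. LBINT y=x0..u. g y) has_vector_derivative g x) (at x within {a..b})"
      using ab by (intro interval_integral_FTC2 continuous_on_subset[OF cont]) auto
    moreover have "at x within {a..b} = at x" using ab by (intro at_within_Icc_at) auto
    ultimately show ?thesis by (simp add: has_real_derivative_iff_has_vector_derivative)
  qed
  with that show thesis by blast
qed

text \<open>An endpoint receives the supremum or infimum of \<open>w\<close>, and \<open>x0\<close>
  tells the two endpoints apart. These extremes are not attained on the open interior, so strictness
  survives; monotonicity and approximation of the extremes give continuity. Boundedness is required
  only on a side whose endpoint belongs to \<open>I\<close>.\<close>

lemma strict_mono_extension:
  fixes w :: "real \<Rightarrow> real"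
  assumes I: "is_interval I" and x0: "x0 \<in> interior I"
    and cont: "continuous_on (interior I) w" and mono: "strict_mono_on (interior I) w"
    and above: "\<And>b. b \<in> I - interior I \<Longrightarrow> x0 < b \<Longrightarrow> bdd_above (w ` interior I)"
    and below: "\<And>a. a \<in> I - interior I \<Longrightarrow> a < x0 \<Longrightarrow> bdd_below (w ` interior I)"
  obtains u where "continuous_on I u" "strict_mono_on I u" "\<And>x. x \<in> interior I \<Longrightarrow> u x = w x"
proof -
  define u where "u x = (if x \<in> interior I then w x
      else if x0 < x then Sup (w ` interior I) else Inf (w ` interior I))" for x
  have u_in: "u x = w x" if "x \<in> interior I" for x using that by (simp add: u_def)
  have x0I: "x0 \<in> I" using x0 interior_subset by blast
  have ne: "w ` interior I \<noteq> {}" using x0 by auto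
  have less_Sup: "w t < Sup (w ` interior I)" if *: "b \<in> I - interior I" "x0 < b" "t \<in> interior I" for b t
  proof -
    obtain t' where t': "t' \<in> interior I" "t < t'" using interior_around[OF *(3)] by metis
    then have "w t < w t'" using strict_mono_onD[OF mono *(3)] by blast
    also have "\<dots> \<le> Sup (w ` interior I)" using t' by (intro cSup_upper above[OF *(1,2)]) auto
    finally show ?thesis .
  qed
  have Inf_less: "Inf (w ` interior I) < w t" if *: "a \<in> I - interior I" "a < x0" "t \<in> interior I" for a t
  proof -
    obtain t' where t': "t' \<in> interior I" "t' < t" using interior_around[OF *(3)] by metis
    then have "Inf (w ` interior I) \<le> w t'" by (intro cInf_lower below[OF *(1,2)]) auto
    also have "\<dots> < w t" using strict_mono_onD[OF mono _ *(3)] t' by blast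
    finally show ?thesis .
  qed
  have top: "t \<le> b" if "b \<in> I - interior I" "x0 < b" "t \<in> I" for b t
    using interior_between[OF I x0I that(3), of b] that by force
  have bot: "a \<le> t" if "a \<in> I - interior I" "a < x0" "t \<in> I" for a t
    using interior_between[OF I that(3) x0I, of a] that by force
  have ne_x0: "x < x0 \<or> x0 < x" if "x \<in> I - interior I" for x
    using that x0 by (metis DiffD2 linorder_neqE_linordered_idom)
  have smono: "strict_mono_on I u"
  proof (rule strict_mono_onI)
    fix x y assume xy: "x \<in> I" "y \<in> I" "x < y"
    consider "x \<in> interior I" "y \<in> interior I" | "x \<in> interior I" "y \<in> I - interior I"
      | "x \<in> I - interior I" "y \<in> interior I" | "x \<in> I - interior I" "y \<in> I - interior I"
      using xy by blast
    then show "u x < u y"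
    proof cases
      case 1
      then show ?thesis using strict_mono_onD[OF mono] xy by (simp add: u_in)
    next
      case 2
      have "x0 < y" using ne_x0[OF 2(2)] bot[OF 2(2) _ xy(1)] xy by force
      then show ?thesis using less_Sup[OF 2(2) _ 2(1)] 2 by (simp add: u_def)
    next
      case 3
      have "x < x0" using ne_x0[OF 3(1)] top[OF 3(1) _ xy(2)] xy by force
      then show ?thesis using Inf_less[OF 3(1) _ 3(2)] 3 by (simp add: u_def)
    next
      case 4
      have "x0 < y" using ne_x0[OF 4(2)] bot[OF 4(2) _ xy(1)] xy by force
      moreover have "x < x0" using ne_x0[OF 4(1)] top[OF 4(1) _ xy(2)] xy by force
      ultimately show ?thesis
        using less_Sup[OF 4(2) _ x0] Inf_less[OF 4(1) _ x0] 4 by (simp add: u_def)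
    qed
  qed
  have "continuous_on I u"
    unfolding continuous_on_eq_continuous_within
  proof
    fix p assume pI: "p \<in> I"
    show "continuous (at p within I) u"
    proof (cases "p \<in> interior I")
      case True
      have "continuous_on (interior I) u"
        using cont continuous_on_cong[of "interior I" "interior I" u w] u_in by simp
      then have "isCont u p" using True by (simp add: continuous_on_eq_continuous_at)
      then show ?thesis by (rule continuous_at_imp_continuous_at_within)
    next
      case False
      then have p: "p \<in> I - interior I" using pI by blast
      show ?thesis
        unfolding continuous_within_eps_delta dist_real_def
      proof (intro allI impI)
        fix e :: real assume e: "0 < e"
        from ne_x0[OF p] show "\<exists>d>0. \<forall>t\<in>I. \<bar>t - p\<bar> < d \<longrightarrow> \<bar>u t - u p\<bar> < e"
        proof
          assume px: "x0 < p"
          have up: "u p = Sup (w ` interior I)" using p px by (simp add: u_def)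
          obtain t0 where t0: "t0 \<in> interior I" "u p - e < w t0"
            using less_cSup_iff[OF ne above[OF p px], of "u p - e"] e up by auto
          have t0I: "t0 \<in> I" using t0 interior_subset by blast
          have "t0 < p" using top[OF p px t0I] t0(1) p by (metis DiffD2 order_le_less)
          moreover have "\<bar>u t - u p\<bar> < e" if t: "t \<in> I" "\<bar>t - p\<bar> < p - t0" for t
          proof -
            have "u t0 \<le> u t" using t t0I by (intro strict_mono_on_leD[OF smono]) auto
            moreover have "u t \<le> u p" using top[OF p px t(1)] t pI by (intro strict_mono_on_leD[OF smono])
            ultimately show ?thesis using t0 u_in[OF t0(1)] e by linarith
          qed
          ultimately show ?thesis by (intro exI[of _ "p - t0"]) auto
        next
          assume px: "p < x0"
          have up: "u p = Inf (w ` interior I)" using p px by (simp add: u_def)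
          obtain t0 where t0: "t0 \<in> interior I" "w t0 < u p + e"
            using cInf_less_iff[OF ne below[OF p px], of "u p + e"] e up by auto
          have t0I: "t0 \<in> I" using t0 interior_subset by blast
          have "p < t0" using bot[OF p px t0I] t0(1) p by (metis DiffD2 order_le_less)
          moreover have "\<bar>u t - u p\<bar> < e" if t: "t \<in> I" "\<bar>t - p\<bar> < t0 - p" for t
          proof -
            have "u t \<le> u t0" using t t0I by (intro strict_mono_on_leD[OF smono]) auto
            moreover have "u p \<le> u t" using bot[OF p px t(1)] t pI by (intro strict_mono_on_leD[OF smono])
            ultimately show ?thesis using t0 u_in[OF t0(1)] e by linarith
          qed
          ultimately show ?thesis by (intro exI[of _ "t0 - p"]) auto
        qed
      qed
    qed
  qed
  with that smono u_in show thesis by blast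
qed

section \<open>Members of \<open>C1_sharp\<close> and the sign of their derivatives\<close>

lemma C1_sharpI:
  assumes "continuous_on I f" "continuous_on (interior I) f'"
    and "\<And>x. x \<in> interior I \<Longrightarrow> (f has_real_derivative f' x) (at x)"
    and "\<And>x. x \<in> interior I \<Longrightarrow> f' x \<noteq> 0"
  shows "f \<in> C1_sharp I"
proof -
  have "f C1_differentiable_on (interior I)"
    unfolding C1_differentiable_on_def
    using assms by (auto simp: has_real_derivative_iff_has_vector_derivative)
  then show ?thesis
    using assms(1,4) DERIV_imp_deriv[OF assms(3)] by (simp add: C1_sharp_def)
qed

lemma C1_sharpE:
  assumes "f \<in> C1_sharp I"
  obtains f' where "continuous_on I f" "continuous_on (interior I) f'"
    "\<And>x. x \<in> interior I \<Longrightarrow> (f has_real_derivative f' x) (at x)"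
    "\<And>x. x \<in> interior I \<Longrightarrow> f' x \<noteq> 0"
proof -
  obtain D where D: "\<And>x. x \<in> interior I \<Longrightarrow> (f has_real_derivative D x) (at x)" "continuous_on (interior I) D"
    using assms by (auto simp: C1_sharp_def C1_differentiable_on_def has_real_derivative_iff_has_vector_derivative)
  have "D x \<noteq> 0" if "x \<in> interior I" for x
    using assms that DERIV_imp_deriv[OF D(1)[OF that]] by (auto simp: C1_sharp_def)
  with D that assms show thesis by (auto simp: C1_sharp_def)
qed

lemma strict_mono_if_pos_deriv:
  fixes f :: "real \<Rightarrow> real"
  assumes I: "is_interval I" and cont: "continuous_on I f"
    and f': "\<And>x. x \<in> interior I \<Longrightarrow> (f has_real_derivative f' x) (at x)"
    and pos: "\<And>x. x \<in> interior I \<Longrightarrow> 0 < f' x"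
  shows "strict_mono_on I f"
proof (rule strict_mono_onI)
  fix x y assume xy: "x \<in> I" "y \<in> I" "x < y"
  have "{x..y} \<subseteq> I" using mem_is_interval_1_I[OF I xy(1,2)] by auto
  then show "f x < f y"
    using interior_between[OF I xy(1,2)] f' pos
    by (intro DERIV_pos_imp_increasing_open[OF xy(3)] continuous_on_subset[OF cont]) blast+
qed

text \<open>A continuous derivative without zeros has constant sign on the connected interior; if it
  is negative, \<open>- f\<close> is used. This also places \<open>f\<close> in
  \<open>CM I\<close>.\<close>

lemma C1_sharp_increasing_representative:
  assumes I: "is_interval I" and f: "f \<in> C1_sharp I"
  obtains g g' where "continuous_on I g" "strict_mono_on I g" "continuous_on (interior I) g'"
    "\<And>x. x \<in> interior I \<Longrightarrow> (g has_real_derivative g' x) (at x)"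
    "\<And>x. x \<in> interior I \<Longrightarrow> 0 < g' x"
    "f \<in> CM I" "\<And>v. v \<in> vectors I \<Longrightarrow> qa_mean I g v = qa_mean I f v"
proof -
  obtain f' where f': "continuous_on I f" "continuous_on (interior I) f'"
    "\<And>x. x \<in> interior I \<Longrightarrow> (f has_real_derivative f' x) (at x)"
    "\<And>x. x \<in> interior I \<Longrightarrow> f' x \<noteq> 0"
    using C1_sharpE[OF f] by metis
  have "connected (interior I)"
    using I by (simp add: is_interval_convex_1 convex_connected convex_interior)
  then have "is_interval (f' ` interior I)"
    using connected_continuous_image[OF f'(2)] by (simp add: is_interval_connected_1)
  then have "(\<forall>x\<in>interior I. 0 < f' x) \<or> (\<forall>x\<in>interior I. f' x < 0)"
    using mem_is_interval_1_I[of "f' ` interior I" _ _ 0] f'(4)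
    by (smt (verit) image_iff)
  then show thesis
  proof
    assume "\<forall>x\<in>interior I. 0 < f' x"
    with f' strict_mono_if_pos_deriv[OF I f'(1,3)] strict_mono_CM[OF f'(1)] that[of f f']
    show thesis by blast
  next
    assume neg: "\<forall>x\<in>interior I. f' x < 0"
    have d: "((\<lambda>x. - f x) has_real_derivative - f' x) (at x)" if "x \<in> interior I" for x
      using f'(3)[OF that] by (rule DERIV_minus)
    have c: "continuous_on I (\<lambda>x. - f x)" using f'(1) by (rule continuous_on_minus)
    have m: "strict_mono_on I (\<lambda>x. - f x)"
      using strict_mono_if_pos_deriv[OF I c d] neg by simp
    then have f: "f \<in> CM I" using uminus_CM[OF strict_mono_CM[OF c m]] by simp
    then have "qa_mean I (\<lambda>x. - f x) v = qa_mean I f v" if "v \<in> vectors I" for v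
      using qa_mean_uminus[OF I _ that] by blast
    with that[OF c m continuous_on_minus[OF f'(2)] d _ f] neg show thesis by simp
  qed
qed

text \<open>The competitors \<open>s\<close> need not be differentiable; only their right
  derivatives are used. The given \<open>s0\<close> guarantees that an admissible function exists
  and later bounds the antiderivative at a right endpoint.\<close>

lemma least_upper_generator:
  assumes I: "is_interval I" and x0: "x0 \<in> interior I" and ne: "F \<noteq> {}" and F: "F \<subseteq> C1_sharp I"
    and s0: "s0 \<in> (\<Inter>f\<in>F. upper_gens I f)"
  obtains u where "u \<in> C1_sharp I" "u \<in> (\<Inter>f\<in>F. upper_gens I f)"
    "\<And>s v. s \<in> (\<Inter>f\<in>F. upper_gens I f) \<Longrightarrow> v \<in> vectors I \<Longrightarrow> qa_mean I u v \<le> qa_mean I s v"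
proof -
  define J where "J = interior I"
  have J: "is_interval J" "open J" "interior J = J" "J \<subseteq> I"
    using I by (auto simp: J_def is_interval_convex_1 interior_subset)
  \<comment> \<open>Bundling these properties lets an increasing generator and its derivative be
    chosen together for each member of \<open>F\<close>.\<close>
  define rep where "rep f g g' \<longleftrightarrow> continuous_on I g \<and> strict_mono_on I g \<and> continuous_on J g' \<and>
    (\<forall>x\<in>J. (g has_real_derivative g' x) (at x) \<and> 0 < g' x) \<and>
    (\<forall>v\<in>vectors I. qa_mean I g v = qa_mean I f v)" for f g g' :: "real \<Rightarrow> real"
  have "\<exists>g g'. rep f g g'" if "f \<in> F" for f
  proof -
    have "f \<in> C1_sharp I" using F that by blast
    from C1_sharp_increasing_representative[OF I this] obtain g g'
      where "continuous_on I g" "strict_mono_on I g" "continuous_on J g'"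
        "\<And>x. x \<in> J \<Longrightarrow> (g has_real_derivative g' x) (at x)" "\<And>x. x \<in> J \<Longrightarrow> 0 < g' x"
        "\<And>v. v \<in> vectors I \<Longrightarrow> qa_mean I g v = qa_mean I f v"
      unfolding J_def by metis
    then have "rep f g g'" by (simp add: rep_def)
    then show ?thesis by blast
  qed
  then obtain g g' where rep: "\<And>f. f \<in> F \<Longrightarrow> rep f (g f) (g' f)" by metis
  have g: "continuous_on I (g f)" "strict_mono_on I (g f)" if "f \<in> F" for f
    using rep[OF that] by (simp_all add: rep_def)
  have g'_cont: "continuous_on J (g' f)" if "f \<in> F" for f
    using rep[OF that] by (simp add: rep_def)
  have g': "(g f has_real_derivative g' f x) (at x)" and g'_pos: "0 < g' f x" if "f \<in> F" "x \<in> J" for f x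
    using rep[OF that(1)] that(2) by (simp_all add: rep_def)
  have g_mean: "qa_mean I (g f) v = qa_mean I f v" if "f \<in> F" "v \<in> vectors I" for f v
    using rep[OF that(1)] that(2) by (simp add: rep_def)
  define \<Phi> where "\<Phi> = (\<lambda>f x. ln (g' f x)) ` F"
  have \<Phi>_ne: "\<Phi> \<noteq> {}" using ne by (simp add: \<Phi>_def)
  have \<Phi>_cont: "continuous_on J \<phi>" if "\<phi> \<in> \<Phi>" for \<phi>
    using that g'_cont g'_pos by (fastforce simp: \<Phi>_def intro!: continuous_on_ln)
  \<comment> \<open>Every common upper generator has an increasing representative that is convex
    over each \<open>g f\<close>. Its right derivative \<open>ds\<close> therefore exists, and
    \<open>ln ds\<close> is admissible for the family \<Phi>.\<close>
  have upper: "\<exists>s ds. continuous_on I s \<and> strict_mono_on I s \<and> (\<forall>v\<in>vectors I. qa_mean I s v = qa_mean I r v) \<and>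
      (\<forall>x\<in>J. (s has_real_derivative ds x) (at_right x)) \<and> (\<forall>x\<in>J. 0 < ds x) \<and>
      (\<forall>\<phi>\<in>\<Phi>. mono_on J (\<lambda>x. ln (ds x) - \<phi> x))"
    if r: "r \<in> (\<Inter>f\<in>F. upper_gens I f)" for r
  proof -
    have "r \<in> CM I" using r ne by (auto simp: upper_gens_def)
    then obtain s where s: "continuous_on I s" "strict_mono_on I s"
      "\<And>v. v \<in> vectors I \<Longrightarrow> qa_mean I s v = qa_mean I r v"
      using CM_increasing_representative[OF I] by metis
    have le: "qa_mean_le I (g f) s" if "f \<in> F" for f
      using I s g[OF that] r that g_mean[OF that]
      by unfold_locales (auto simp: upper_gens_def)
    obtain f0 where f0: "f0 \<in> F" using ne by blast
    have "\<forall>x\<in>J. \<exists>d>0. (s has_real_derivative d) (at_right x)"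
      using qa_mean_le.right_deriv_exists[OF le[OF f0] _ g'[OF f0] g'_pos[OF f0]] by (simp add: J_def)
    then obtain ds where ds: "\<And>x. x \<in> J \<Longrightarrow> 0 < ds x" "\<And>x. x \<in> J \<Longrightarrow> (s has_real_derivative ds x) (at_right x)"
      by metis
    have "mono_on J (\<lambda>x. ln (ds x) - ln (g' f x))" if f: "f \<in> F" for f
    proof (rule mono_onI)
      fix x y assume xy: "x \<in> J" "y \<in> J" "x \<le> y"
      have "mono_on J (\<lambda>x. ds x / g' f x)"
        unfolding J_def using g'[OF f] g'_pos[OF f] ds
        by (intro qa_mean_le.deriv_ratio_mono[OF le[OF f]]) (auto simp: J_def)
      from mono_onD[OF this xy] have "ln (ds x / g' f x) \<le> ln (ds y / g' f y)"
        using ds g'_pos[OF f] xy by (intro ln_mono) auto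
      then show "ln (ds x) - ln (g' f x) \<le> ln (ds y) - ln (g' f y)"
        using ds(1)[OF xy(1)] ds(1)[OF xy(2)] g'_pos[OF f xy(1)] g'_pos[OF f xy(2)] by (simp add: ln_div)
    qed
    then have "\<forall>\<phi>\<in>\<Phi>. mono_on J (\<lambda>x. ln (ds x) - \<phi> x)" by (auto simp: \<Phi>_def)
    with s ds show ?thesis by blast
  qed
  obtain s1 ds1 where "continuous_on I s1" "strict_mono_on I s1"
      "\<forall>x\<in>J. (s1 has_real_derivative ds1 x) (at_right x)" "\<forall>x\<in>J. 0 < ds1 x"
      "\<forall>\<phi>\<in>\<Phi>. mono_on J (\<lambda>x. ln (ds1 x) - \<phi> x)"
    using upper[OF s0] by blast
  note s1 = this[rule_format]
  obtain h where h: "continuous_on J h" "\<And>\<phi>. \<phi> \<in> \<Phi> \<Longrightarrow> mono_on J (\<lambda>x. h x - \<phi> x)"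
    "\<And>k. (\<And>\<phi>. \<phi> \<in> \<Phi> \<Longrightarrow> mono_on J (\<lambda>x. k x - \<phi> x)) \<Longrightarrow> mono_on J (\<lambda>x. k x - h x)"
    using least_increment_majorant[OF \<Phi>_ne \<Phi>_cont s1(5)] by blast
  \<comment> \<open>Exponentiating turns monotone differences of logarithms into monotone ratios.
    Minimality of \<open>h\<close> thus makes competitors convex over an antiderivative of
    \<open>exp h\<close>; admissibility of \<open>h\<close>, used in \<open>h_ratio\<close>, makes
    that antiderivative convex over each \<open>g f\<close>.\<close>
  have ratio_h: "mono_on J (\<lambda>x. ds x / exp (h x))"
    if "\<And>x. x \<in> J \<Longrightarrow> 0 < ds x" "\<And>\<phi>. \<phi> \<in> \<Phi> \<Longrightarrow> mono_on J (\<lambda>x. ln (ds x) - \<phi> x)" for ds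
  proof (rule mono_onI)
    fix x y assume xy: "x \<in> J" "y \<in> J" "x \<le> y"
    have "exp (ln (ds x) - h x) \<le> exp (ln (ds y) - h y)"
      using mono_onD[OF h(3)[OF that(2)] xy] by simp
    then show "ds x / exp (h x) \<le> ds y / exp (h y)"
      using that(1) xy by (simp add: exp_diff)
  qed
  have h_ratio: "mono_on J (\<lambda>x. exp (h x) / g' f x)" if f: "f \<in> F" for f
  proof (rule mono_onI)
    fix x y assume xy: "x \<in> J" "y \<in> J" "x \<le> y"
    have "mono_on J (\<lambda>x. h x - ln (g' f x))" using f by (intro h(2)) (auto simp: \<Phi>_def)
    from mono_onD[OF this xy] have "exp (h x - ln (g' f x)) \<le> exp (h y - ln (g' f y))" by simp
    then show "exp (h x) / g' f x \<le> exp (h y) / g' f y"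
      using g'_pos[OF f] xy by (simp add: exp_diff)
  qed
  obtain w where w: "\<And>x. x \<in> J \<Longrightarrow> (w has_real_derivative exp (h x)) (at x)"
    using antiderivative_on_open_interval[OF J(1,2) continuous_on_exp[OF h(1)]] by blast
  have w_cont: "continuous_on J w"
    using w DERIV_isCont by (blast intro: continuous_at_imp_continuous_on)
  have w_mono: "strict_mono_on J w"
    using w by (intro strict_mono_if_pos_deriv[OF J(1) w_cont, of "\<lambda>x. exp (h x)"]) (auto simp: J(3))
  have x0J: "x0 \<in> J" using x0 by (simp add: J_def)
  have right_w: "(w has_real_derivative exp (h x)) (at_right x)" if "x \<in> J" for x
    using w[OF that] by (rule has_field_derivative_at_within)
  text \<open>Near a right endpoint \<open>w\<close> is controlled by \<open>s1\<close>, near a left endpoint by any member of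
    the family.\<close>
  have above: "bdd_above (w ` J)" if b: "b \<in> I - interior I" "x0 < b" for b
  proof (rule bdd_aboveI2)
    fix t assume t: "t \<in> J"
    \<comment> \<open>\<open>c\<close> is the slope at \<open>x0\<close> of the supporting line of
      \<open>s1\<close> over \<open>w\<close>; this line bounds \<open>w\<close> above by an affine
      function of \<open>s1\<close>.\<close>
    define c where "c = ds1 x0 / exp (h x0)"
    have "0 < c" using s1(4)[OF x0J] by (simp add: c_def)
    have "c * (w t - w x0) \<le> s1 t - s1 x0" unfolding c_def
      using s1(3) right_w ratio_h[OF s1(4,5)] x0J t
      by (intro subgradient_if_deriv_ratio_mono[OF J(1)] w_cont continuous_on_subset[OF s1(1) J(4)])
        (auto simp: J(3))
    moreover have "t \<le> b"
      using interior_between[of I x0 t b] b t J(4) x0J I by force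
    then have "s1 t \<le> s1 b" using b t J(4) by (intro strict_mono_on_leD[OF s1(2)]) auto
    ultimately have "c * (w t - w x0) \<le> s1 b - s1 x0" by simp
    then show "w t \<le> (s1 b - s1 x0) / c + w x0" using \<open>0 < c\<close> by (simp add: field_simps)
  qed
  obtain f0 where f0: "f0 \<in> F" using ne by blast
  have below: "bdd_below (w ` J)" if a: "a \<in> I - interior I" "a < x0" for a
  proof (rule bdd_belowI2)
    fix t assume t: "t \<in> J"
    \<comment> \<open>Here \<open>w\<close> is the function convex over \<open>g f0\<close>, so its
      supporting line at \<open>x0\<close> bounds it from below.\<close>
    define c where "c = exp (h x0) / g' f0 x0"
    have "0 < c" using g'_pos[OF f0 x0J] by (simp add: c_def)
    have "c * (g f0 t - g f0 x0) \<le> w t - w x0" unfolding c_def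
      using g'_pos[OF f0] h_ratio[OF f0] right_w x0J t
      by (intro subgradient_if_deriv_ratio_mono[OF J(1)] w_cont continuous_on_subset[OF g(1)[OF f0] J(4)])
        (auto simp: J(3) intro: has_field_derivative_at_within[OF g'[OF f0]])
    moreover have "a \<le> t"
      using interior_between[of I t x0 a] a t J(4) x0J I by force
    then have "g f0 a \<le> g f0 t" using a t J(4) by (intro strict_mono_on_leD[OF g(2)[OF f0]]) auto
    then have "c * (g f0 a - g f0 x0) \<le> c * (g f0 t - g f0 x0)" using \<open>0 < c\<close> by simp
    ultimately show "c * (g f0 a - g f0 x0) + w x0 \<le> w t" by simp
  qed
  obtain u where u: "continuous_on I u" "strict_mono_on I u" "\<And>x. x \<in> J \<Longrightarrow> u x = w x"
    using strict_mono_extension[OF I x0 w_cont[unfolded J_def] w_mono[unfolded J_def]] above below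
    unfolding J_def by metis
  have u': "(u has_real_derivative exp (h x)) (at x)" if "x \<in> J" for x
    using has_field_derivative_transform_within_open[OF w[OF that] J(2) that] u(3) by simp
  have right_u: "(u has_real_derivative exp (h x)) (at_right x)" if "x \<in> J" for x
    using u'[OF that] by (rule has_field_derivative_at_within)
  have "u \<in> C1_sharp I"
    using u(1) u' continuous_on_exp[OF h(1)] by (intro C1_sharpI) (auto simp: J_def)
  moreover have "u \<in> upper_gens I f" if f: "f \<in> F" for f
  proof -
    \<comment> \<open>Monotone ratios in the interior give supporting lines over all of
      \<open>I\<close>, endpoints included, because \<open>u\<close> is continuous there.\<close>
    have "qa_mean I (g f) v \<le> qa_mean I u v" if v: "v \<in> vectors I" for v
    proof (rule qa_mean_le_if_subgradient[OF I g[OF f] u(1,2) _ v])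
      fix x t assume "x \<in> interior I" "t \<in> I"
      then show "exp (h x) / g' f x * (g f t - g f x) \<le> u t - u x"
        using g'_pos[OF f] h_ratio[OF f] right_u
        by (intro subgradient_if_deriv_ratio_mono[OF I u(1) g(1)[OF f]])
          (auto simp: J_def intro: has_field_derivative_at_within[OF g'[OF f, unfolded J_def]])
    qed
    then show ?thesis
      using strict_mono_CM[OF u(1,2)] g_mean[OF f] by (auto simp: upper_gens_def)
  qed
  moreover have "qa_mean I u v \<le> qa_mean I r v"
    if r: "r \<in> (\<Inter>f\<in>F. upper_gens I f)" and v: "v \<in> vectors I" for r v
  proof -
    obtain s ds where "continuous_on I s" "strict_mono_on I s"
      "\<forall>v\<in>vectors I. qa_mean I s v = qa_mean I r v"
      "\<forall>x\<in>J. (s has_real_derivative ds x) (at_right x)" "\<forall>x\<in>J. 0 < ds x"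
      "\<forall>\<phi>\<in>\<Phi>. mono_on J (\<lambda>x. ln (ds x) - \<phi> x)"
      using upper[OF r] by blast
    note s = this(1-3)[rule_format] and ds = this(4-6)[rule_format]
    have "qa_mean I u v \<le> qa_mean I s v"
    proof (rule qa_mean_le_if_subgradient[OF I u(1,2) s(1,2) _ v])
      fix x t assume "x \<in> interior I" "t \<in> I"
      then show "ds x / exp (h x) * (u t - u x) \<le> s t - s x"
        using ds(1) ratio_h[OF ds(2,3)] right_u
        by (intro subgradient_if_deriv_ratio_mono[OF I s(1) u(1)]) (auto simp: J_def)
    qed
    then show ?thesis using s(3)[OF v] by simp
  qed
  ultimately show thesis using that by blast
qed

subsection \<open>Reflection\<close>

lemma interior_uminus: "interior (uminus ` I) = uminus ` interior I" for I :: "real set"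
  using interior_injective_linear_image[of uminus I] by (simp add: linear_uminus)

lemma reflect_CM:
  assumes "f \<in> CM I"
  shows "(\<lambda>x. f (- x)) \<in> CM (uminus ` I)"
proof -
  have f: "continuous_on I f" using assms by (simp add: CM_def)
  have "continuous_on (uminus ` I) (\<lambda>x. f (- x))"
    by (rule continuous_on_compose2[OF f continuous_on_minus[OF continuous_on_id]]) auto
  moreover have "strict_mono_on (uminus ` I) (\<lambda>x. f (- x)) \<or> strict_antimono_on (uminus ` I) (\<lambda>x. f (- x))"
    using assms by (auto simp: CM_def monotone_on_def)
  ultimately show ?thesis by (simp add: CM_def)
qed

lemma reflect_C1_sharp:
  assumes "f \<in> C1_sharp I"
  shows "(\<lambda>x. f (- x)) \<in> C1_sharp (uminus ` I)"
proof -
  obtain f' where f': "continuous_on I f" "continuous_on (interior I) f'"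
    "\<And>x. x \<in> interior I \<Longrightarrow> (f has_real_derivative f' x) (at x)"
    "\<And>x. x \<in> interior I \<Longrightarrow> f' x \<noteq> 0"
    using C1_sharpE[OF assms] by metis
  show ?thesis
  proof (rule C1_sharpI[where f' = "\<lambda>x. - f' (- x)"])
    show "continuous_on (uminus ` I) (\<lambda>x. f (- x))"
      by (rule continuous_on_compose2[OF f'(1) continuous_on_minus[OF continuous_on_id]]) auto
    show "continuous_on (interior (uminus ` I)) (\<lambda>x. - f' (- x))"
      unfolding interior_uminus
      by (rule continuous_on_minus,
          rule continuous_on_compose2[OF f'(2) continuous_on_minus[OF continuous_on_id]]) auto
    fix x assume "x \<in> interior (uminus ` I)"
    then have x: "- x \<in> interior I" by (auto simp: interior_uminus)
    show "((\<lambda>x. f (- x)) has_real_derivative - f' (- x)) (at x)"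
      using f'(3)[OF x] by (simp add: DERIV_mirror)
    show "- f' (- x) \<noteq> 0" using f'(4)[OF x] by simp
  qed
qed

lemma reflect_vectors: "v \<in> vectors I \<Longrightarrow> map uminus v \<in> vectors (uminus ` I)"
  by (auto simp: vectors_def)

lemma reflect_qa_mean:
  assumes "is_interval I" "f \<in> CM I" "v \<in> vectors I"
  shows "qa_mean (uminus ` I) (\<lambda>x. f (- x)) (map uminus v) = - qa_mean I f v"
  by (intro qa_mean_eqI reflect_CM assms)
    (use qa_mean_props[OF assms] in \<open>simp_all add: o_def\<close>)

text \<open>Reflection turns a mean into its negative and so reverses inequalities between
  means.\<close>

lemma reflect_lower_gens:
  assumes I: "is_interval I" and f: "f \<in> CM I"
  shows "s \<in> lower_gens I f \<longleftrightarrow> (\<lambda>x. s (- x)) \<in> upper_gens (uminus ` I) (\<lambda>x. f (- x))"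
proof -
  have CM: "s \<in> CM I \<longleftrightarrow> (\<lambda>x. s (- x)) \<in> CM (uminus ` I)"
    using reflect_CM[of s I] reflect_CM[of "\<lambda>x. s (- x)" "uminus ` I"] by (auto simp: image_image)
  have vec: "vectors (uminus ` I) = map uminus ` vectors I"
    using reflect_vectors[of _ "uminus ` I"] reflect_vectors[of _ I]
    by (force simp: image_image o_def image_iff intro: bexI[of _ "map uminus _"])
  show ?thesis
    using CM reflect_qa_mean[OF I] f by (auto simp: lower_gens_def upper_gens_def vec)
qed

text \<open>The least common upper generator of the reflected family, reflected back, is the
  greatest common lower generator.\<close>

lemma greatest_lower_generator:
  assumes I: "is_interval I" and x0: "x0 \<in> interior I" and ne: "F \<noteq> {}" and F: "F \<subseteq> C1_sharp I"
    and s0: "s0 \<in> (\<Inter>f\<in>F. lower_gens I f)"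
  obtains l where "l \<in> C1_sharp I" "l \<in> (\<Inter>f\<in>F. lower_gens I f)"
    "\<And>s v. s \<in> (\<Inter>f\<in>F. lower_gens I f) \<Longrightarrow> v \<in> vectors I \<Longrightarrow> qa_mean I s v \<le> qa_mean I l v"
proof -
  let ?I = "uminus ` I" and ?F = "(\<lambda>f x. f (- x)) ` F"
  have CM: "f \<in> CM I" if "f \<in> F" for f
    using C1_sharp_increasing_representative[OF I] F that by (metis subsetD)
  have iff: "s \<in> (\<Inter>f\<in>F. lower_gens I f) \<longleftrightarrow> (\<lambda>x. s (- x)) \<in> (\<Inter>f\<in>?F. upper_gens ?I f)" for s
    using reflect_lower_gens[OF I CM] by simp
  have "?F \<subseteq> C1_sharp ?I" using F reflect_C1_sharp by blast
  moreover have "- x0 \<in> interior ?I" using x0 by (simp add: interior_uminus)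
  ultimately obtain u where u: "u \<in> C1_sharp ?I" "u \<in> (\<Inter>f\<in>?F. upper_gens ?I f)"
    "\<And>s v. s \<in> (\<Inter>f\<in>?F. upper_gens ?I f) \<Longrightarrow> v \<in> vectors ?I \<Longrightarrow> qa_mean ?I u v \<le> qa_mean ?I s v"
    using least_upper_generator[OF is_interval_uminusI[OF I], of "- x0" ?F] ne s0 iff by (metis image_is_empty)
  define l where "l x = u (- x)" for x
  have u_l: "u = (\<lambda>x. l (- x))" by (simp add: l_def)
  have "l \<in> C1_sharp I" using reflect_C1_sharp[OF u(1)] by (simp add: l_def[abs_def] image_image)
  moreover have l: "l \<in> (\<Inter>f\<in>F. lower_gens I f)" using u(2) iff unfolding u_l by blast
  moreover have "qa_mean I s v \<le> qa_mean I l v"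
    if s: "s \<in> (\<Inter>f\<in>F. lower_gens I f)" and v: "v \<in> vectors I" for s v
  proof -
    have "s \<in> CM I" "l \<in> CM I" using s l ne by (auto simp: lower_gens_def)
    then show ?thesis
      using u(3)[OF _ reflect_vectors[OF v]] s iff reflect_qa_mean[OF I _ v] unfolding u_l by fastforce
  qed
  ultimately show thesis using that by blast
qed

section \<open>From extremal generators to the envelopes\<close>

theorem theorem3p4:
  fixes I :: "real set" and F :: "(real \<Rightarrow> real) set"
  assumes "is_interval I" and "\<exists>x\<in>I. \<exists>y\<in>I. x < y"
    and "F \<noteq> {}" and "F \<subseteq> C1_sharp I"
  shows "((\<exists>u\<in>C1_sharp I. \<forall>v\<in>vectors I. upper_env I F v = qa_mean I u v) \<or>
          (\<forall>v\<in>vectors I. upper_env I F v = Max (set v))) \<and>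
         ((\<exists>l\<in>C1_sharp I. \<forall>v\<in>vectors I. lower_env I F v = qa_mean I l v) \<or>
          (\<forall>v\<in>vectors I. lower_env I F v = Min (set v)))"
proof
  obtain x y where xy: "x \<in> I" "y \<in> I" "x < y" using assms(2) by blast
  \<comment> \<open>The midpoint provides the interior base point that both extremal constructions
    require.\<close>
  then have mid: "(x + y) / 2 \<in> interior I"
    by (intro interior_between[OF assms(1) xy(1,2)]) auto
  let ?U = "\<Inter>f\<in>F. upper_gens I f" and ?L = "\<Inter>f\<in>F. lower_gens I f"
  show "(\<exists>u\<in>C1_sharp I. \<forall>v\<in>vectors I. upper_env I F v = qa_mean I u v) \<or>
          (\<forall>v\<in>vectors I. upper_env I F v = Max (set v))"
  proof (cases "?U = {}")
    case True
    then show ?thesis by (simp add: upper_env_def)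
  next
    case False
    then obtain s0 where "s0 \<in> ?U" by blast
    from least_upper_generator[OF assms(1) mid assms(3,4) this]
    obtain u where u: "u \<in> C1_sharp I" "u \<in> ?U"
      "\<And>s v. s \<in> ?U \<Longrightarrow> v \<in> vectors I \<Longrightarrow> qa_mean I u v \<le> qa_mean I s v" by blast
    have "upper_env I F v = qa_mean I u v" if "v \<in> vectors I" for v
    proof -
      \<comment> \<open>The infimum is a minimum, since \<open>u\<close> is itself one of the
        competitors.\<close>
      have "(INF s\<in>?U. qa_mean I s v) = qa_mean I u v"
        using u that by (intro cInf_eq_minimum) auto
      then show ?thesis using False by (simp add: upper_env_def)
    qed
    with u(1) show ?thesis by blast
  qed
  show "(\<exists>l\<in>C1_sharp I. \<forall>v\<in>vectors I. lower_env I F v = qa_mean I l v) \<or>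
          (\<forall>v\<in>vectors I. lower_env I F v = Min (set v))"
  proof (cases "?L = {}")
    case True
    then show ?thesis by (simp add: lower_env_def)
  next
    case False
    then obtain s0 where "s0 \<in> ?L" by blast
    from greatest_lower_generator[OF assms(1) mid assms(3,4) this]
    obtain l where l: "l \<in> C1_sharp I" "l \<in> ?L"
      "\<And>s v. s \<in> ?L \<Longrightarrow> v \<in> vectors I \<Longrightarrow> qa_mean I s v \<le> qa_mean I l v" by blast
    have "lower_env I F v = qa_mean I l v" if "v \<in> vectors I" for v
    proof -
      have "(SUP s\<in>?L. qa_mean I s v) = qa_mean I l v"
        using l that by (intro cSup_eq_maximum) auto
      then show ?thesis using False by (simp add: lower_env_def)
    qed
    with l(1) show ?thesis by blast
  qed
qed

end
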